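(* Let $\mathcal{X}=[1,2]\subset\mathbb{R}$, fix $s\in[0,3]$, and let $P$ be the probability distribution on $\mathcal{X}$ with the piecewise constant density $p(x)=s$ if $4/3\le x<5/3$ and $p(x)=(3-s)/2$ otherwise. Let $k(x,y)=xy$. Then the only eigenvalue of $U$ outside of $\mathrm{rg}(d)$ is the trivial eigenvalue $0$, with multiplicity one.
   Context: $d(x)=\int k(x,y)\,dP(y)$ is the degree function, $\mathrm{rg}(d)=d(\mathcal{X})$ its range, and $U:C(\mathcal{X})\to C(\mathcal{X})$ is the operator $Uf(x)=d(x)f(x)-\int k(x,y)f(y)\,dP(y)$. *)

theory Defs
  imports "HOL-Analysis.Analysis" "HOL-Library.Function_Algebras"
begin

(* Functions on a subset X of a type are represented by total functions that are 0 off X, so that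
   equality of total functions is equality on X, and C(X) is a linear subspace of the pointwise
   function space. *)

definition scale_fun :: "'k::field \<Rightarrow> ('x \<Rightarrow> 'k) \<Rightarrow> 'x \<Rightarrow> 'k" where
  "scale_fun c f = (\<lambda>x. c * f x)"

interpretation function_space: vector_space "scale_fun :: 'k::field \<Rightarrow> ('x \<Rightarrow> 'k) \<Rightarrow> 'x \<Rightarrow> 'k"
  by unfold_locales (auto simp: scale_fun_def fun_eq_iff algebra_simps)

definition cont_space :: "'x::topological_space set \<Rightarrow> ('x \<Rightarrow> 'k::real_normed_field) set" where
  "cont_space X = {f. continuous_on X f \<and> (\<forall>x. x \<notin> X \<longrightarrow> f x = 0)}"

lemma subspace_cont_space: "function_space.subspace (cont_space X)"
  by (auto simp: function_space.subspace_def cont_space_def scale_fun_def plus_fun_def zero_fun_def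
      intro!: continuous_intros)

definition degree_fun :: "'x measure \<Rightarrow> ('x \<Rightarrow> 'x \<Rightarrow> real) \<Rightarrow> 'x \<Rightarrow> real" where
  "degree_fun P k x = (\<integral>y. k x y \<partial>P)"

definition U_op :: "'x set \<Rightarrow> 'x measure \<Rightarrow> ('x \<Rightarrow> 'x \<Rightarrow> real) \<Rightarrow>
    ('x \<Rightarrow> 'k) \<Rightarrow> 'x \<Rightarrow> 'k::{real_normed_field, banach, second_countable_topology}" where
  "U_op X P k f = (\<lambda>x. if x \<in> X
     then degree_fun P k x *\<^sub>R f x - (\<integral>y. k x y *\<^sub>R f y \<partial>P) else 0)"

definition eigenspace ::
  "('x \<Rightarrow> 'k::field) set \<Rightarrow> (('x \<Rightarrow> 'k) \<Rightarrow> 'x \<Rightarrow> 'k) \<Rightarrow> 'k \<Rightarrow> ('x \<Rightarrow> 'k) set" where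
  "eigenspace V T c = {f \<in> V. T f = scale_fun c f}"

definition eigenvalue ::
  "('x \<Rightarrow> 'k::field) set \<Rightarrow> (('x \<Rightarrow> 'k) \<Rightarrow> 'x \<Rightarrow> 'k) \<Rightarrow> 'k \<Rightarrow> bool" where
  "eigenvalue V T c \<longleftrightarrow> (\<exists>f \<in> eigenspace V T c. f \<noteq> 0)"

definition generalized_eigenspace ::
  "('x \<Rightarrow> 'k::field) set \<Rightarrow> (('x \<Rightarrow> 'k) \<Rightarrow> 'x \<Rightarrow> 'k) \<Rightarrow> 'k \<Rightarrow> ('x \<Rightarrow> 'k) set" where
  "generalized_eigenspace V T c = {f \<in> V. \<exists>n. ((\<lambda>g. T g - scale_fun c g) ^^ n) f = 0}"

(* Pitfall: "dim" is 0 for infinite-dimensional spaces; the value 1 always means a line. *)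

definition geometric_multiplicity ::
  "('x \<Rightarrow> 'k::field) set \<Rightarrow> (('x \<Rightarrow> 'k) \<Rightarrow> 'x \<Rightarrow> 'k) \<Rightarrow> 'k \<Rightarrow> nat" where
  "geometric_multiplicity V T c = function_space.dim (eigenspace V T c)"

definition algebraic_multiplicity ::
  "('x \<Rightarrow> 'k::field) set \<Rightarrow> (('x \<Rightarrow> 'k) \<Rightarrow> 'x \<Rightarrow> 'k) \<Rightarrow> 'k \<Rightarrow> nat" where
  "algebraic_multiplicity V T c = function_space.dim (generalized_eigenspace V T c)"

end

(* Here d x = m x with m the mean of P, so an eigenfunction f for c satisfies
   (m x - c) f x = x B with B the integral of y f y. For c outside the range of d this determines f
   up to the factor B, and integrating y f y gives c B J = 0 with J the integral of y / (m y - c).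
   J does not vanish: for real c the integrand has constant sign, for other c its imaginary part has.
   If U f is in the kernel of U, it is a constant b, whence f x = B / m + b / (m x); integrating
   y f y gives b = 0, so the generalized eigenspace of 0 is the kernel, the constants. *)
theory Submission
  imports Defs
begin

text \<open>\<open>sets_P\<close> and \<open>compact\<close> make continuous functions on
  \<open>X\<close> integrable, \<open>positive\<close> fixes the sign of the weight
  \<open>y\<close>, and \<open>mass\<close> excludes the null measure.\<close>

locale product_kernel = finite_measure P for P :: "real measure" +
  fixes X :: "real set"
  assumes compact: "compact X"
    and positive: "X \<subseteq> {0<..}"
    and sets_P: "sets P = sets (restrict_space borel X)"
    and mass: "emeasure P X \<noteq> 0"
begin

abbreviation k :: "real \<Rightarrow> real \<Rightarrow> real" where "k \<equiv> \<lambda>x y. x * y"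

definition m :: real where "m = (\<integral>y. y \<partial>P)"

lemma space_P: "space P = X"
  using sets_eq_imp_space_eq[OF sets_P] by (simp add: space_restrict_space)

lemma X_nonempty: "X \<noteq> {}"
  using mass by auto

section \<open>Integrals of continuous functions on \<open>X\<close>\<close>

lemma integrable_continuous:
  fixes f :: "real \<Rightarrow> 'b::{banach, second_countable_topology}"
  assumes "continuous_on X f"
  shows "integrable P f"
proof -
  have "f \<in> borel_measurable P"
    using borel_measurable_continuous_on_restrict[OF assms] measurable_cong_sets[OF sets_P refl] by blast
  moreover obtain C where "\<And>x. x \<in> X \<Longrightarrow> norm (f x) \<le> C"
    using compact_imp_bounded[OF compact_continuous_image[OF assms compact]]
    by (auto simp: bounded_iff)
  ultimately show ?thesis
    by (intro integrable_const_bound[of f C]) (auto simp: space_P)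
qed

text \<open>A vanishing integral of a nonnegative function would force \<open>f = 0\<close> almost
  everywhere; as \<open>f\<close> has no zero on \<open>X\<close>, the whole space would be null,
  against \<open>mass\<close>.\<close>

lemma integral_pos:
  fixes f :: "real \<Rightarrow> real"
  assumes "continuous_on X f" and pos: "\<And>x. x \<in> X \<Longrightarrow> 0 < f x"
  shows "0 < (\<integral>x. f x \<partial>P)"
proof -
  have nonneg: "AE x in P. 0 \<le> f x"
    using pos by (intro AE_I2) (auto simp: space_P less_imp_le)
  have "(\<integral>x. f x \<partial>P) \<noteq> 0"
  proof
    assume "(\<integral>x. f x \<partial>P) = 0"
    then have "AE x in P. f x = 0"
      using integral_nonneg_eq_0_iff_AE[OF integrable_continuous[OF assms(1)] nonneg] by simp
    then have "AE x in P. False"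
      by (rule AE_mp) (use pos in \<open>force simp: space_P intro!: AE_I2\<close>)
    then show False
      using mass by (simp add: ae_filter_eq_bot_iff eventually_False space_P)
  qed
  then show ?thesis
    using integral_nonneg_AE[OF nonneg] by simp
qed

section \<open>The mean and the shape of the operator\<close>

lemma m_pos: "0 < m"
  unfolding m_def using positive by (intro integral_pos) (auto intro!: continuous_intros)

lemma degree: "degree_fun P k x = m * x"
  by (simp add: degree_fun_def m_def)

text \<open>The kernel factors, so \<open>x\<close> leaves the integral: \<open>U\<close> is
  multiplication by \<open>m * x\<close> minus an operator of rank at most one.\<close>

lemma U_op_apply:
  fixes f :: "real \<Rightarrow> 'k::{real_normed_field, banach, second_countable_topology}"
  assumes "x \<in> X"
  shows "U_op X P k f x = of_real (m * x) * f x - of_real x * (\<integral>y. of_real y * f y \<partial>P)"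
proof -
  have "(\<integral>y. (x * y) *\<^sub>R f y \<partial>P) = (\<integral>y. x *\<^sub>R (of_real y * f y) \<partial>P)"
    by (simp add: scaleR_conv_of_real mult.assoc)
  then show ?thesis
    using assms unfolding U_op_def degree by (simp add: scaleR_conv_of_real)
qed

lemma integral_of_real_id: "(\<integral>y. of_real y \<partial>P) = (of_real m :: 'k::{real_normed_field, banach, second_countable_topology})"
  unfolding m_def
  by (rule integral_bounded_linear[OF bounded_linear_of_real]) (intro integrable_continuous continuous_intros)

section \<open>Eigenfunctions for nonzero \<open>c\<close> outside the range of the degree\<close>

lemma resolvent_integral_zero:
  fixes f :: "real \<Rightarrow> 'k::{real_normed_field, banach, second_countable_topology}"
  assumes f: "f \<in> eigenspace (cont_space X) (U_op X P k) c" and "f \<noteq> 0"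
    and c: "c \<notin> of_real ` degree_fun P k ` X" and "c \<noteq> 0"
  shows "(\<integral>y. of_real y / (of_real (m * y) - c) \<partial>P) = 0"
proof -
  define B where "B = (\<integral>y. of_real y * f y \<partial>P)"
  define J where "J = (\<integral>y. of_real y / (of_real (m * y) - c) \<partial>P)"
  have nz: "of_real m * of_real x - c \<noteq> 0" if "x \<in> X" for x
    using c that degree by (auto simp: image_iff)
  have m: "of_real m \<noteq> (0 :: 'k)"
    using m_pos by simp
  have f_eq: "f x = of_real x * B / (of_real m * of_real x - c)" if "x \<in> X" for x
  proof -
    have "U_op X P k f x = c * f x"
      using f by (simp add: eigenspace_def scale_fun_def)
    then show ?thesis
      using nz[OF that] by (simp add: U_op_apply[OF that] B_def field_simps)
  qed
  \<comment> \<open>\<open>B = 0\<close> would make \<open>f\<close> vanish on \<open>X\<close>, and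
    members of \<open>cont_space X\<close> vanish off \<open>X\<close> anyway.\<close>
  have "B \<noteq> 0"
  proof
    assume "B = 0"
    then have "f x = 0" for x
      using f f_eq by (cases "x \<in> X") (auto simp: eigenspace_def cont_space_def)
    then show False
      using \<open>f \<noteq> 0\<close> by (auto simp: zero_fun_def)
  qed
  \<comment> \<open>Polynomial division: y^2 / (m y - c) = y / m + (c / m) * y / (m y - c). The
    first term integrates back to \<open>B\<close>, which leaves
    \<open>B * c / m * J = 0\<close>.\<close>
  have "B = (\<integral>y. B / of_real m * of_real y
      + B * c / of_real m * (of_real y / (of_real (m * y) - c)) \<partial>P)"
    unfolding B_def
  proof (intro Bochner_Integration.integral_cong refl)
    fix y assume "y \<in> space P"
    then have y: "y \<in> X"
      by (simp add: space_P)
    have "of_real y * f y = B / of_real m * of_real y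
        + B * c / of_real m * (of_real y / (of_real (m * y) - c))"
      using f_eq[OF y] nz[OF y] m by (simp add: divide_simps) (simp add: algebra_simps)
    then show "of_real y * f y = (\<integral>y. of_real y * f y \<partial>P) / of_real m * of_real y
        + (\<integral>y. of_real y * f y \<partial>P) * c / of_real m * (of_real y / (of_real (m * y) - c))"
      by (simp only: B_def)
  qed
  also have "\<dots> = (\<integral>y. B / of_real m * of_real y \<partial>P)
      + (\<integral>y. B * c / of_real m * (of_real y / (of_real (m * y) - c)) \<partial>P)"
    by (intro Bochner_Integration.integral_add integrable_continuous)
      (use nz m_pos in \<open>auto intro!: continuous_intros\<close>)
  also have "\<dots> = B / of_real m * of_real m + B * c / of_real m * J"
    by (simp only: integral_mult_right_zero integral_of_real_id J_def)
  finally show ?thesis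
    using m \<open>B \<noteq> 0\<close> \<open>c \<noteq> 0\<close> by (simp add: J_def)
qed

text \<open>As \<open>X\<close> is an interval, so is the range of the degree, and \<open>c\<close>
  lies strictly on one side of it. In a gap of a disconnected \<open>X\<close> the integrand would
  change sign.\<close>

lemma real_resolvent_integral_nonzero:
  assumes "X = {a..b}" and c: "c \<notin> degree_fun P k ` X"
  shows "(\<integral>y. y / (m * y - c) \<partial>P) \<noteq> 0"
proof -
  have "a \<le> b"
    using X_nonempty assms(1) by auto
  have nz: "m * x - c \<noteq> 0" if "x \<in> X" for x
    using c that degree by (auto simp: image_iff)
  have cont: "continuous_on X (\<lambda>y. y / (m * y - c))"
    using nz by (auto intro!: continuous_intros)
  consider "c < m * a" | "m * b < c"
  proof -
    have "\<not> (m * a \<le> c \<and> c \<le> m * b)"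
    proof
      assume "m * a \<le> c \<and> c \<le> m * b"
      \<comment> \<open>\<open>c / m\<close> is the point at which the degree takes the value
        \<open>c\<close>.\<close>
      then have "c / m \<in> X"
        using m_pos assms(1) by (simp add: field_simps)
      then show False
        using nz[of "c / m"] m_pos by simp
    qed
    then show thesis
      using that by linarith
  qed
  then show ?thesis
  proof cases
    case 1
    have "0 < y / (m * y - c)" if "y \<in> X" for y
    proof (rule divide_pos_pos)
      show "0 < m * y - c"
        using mult_left_mono[of a y m] that 1 m_pos unfolding assms(1) atLeastAtMost_iff by linarith
    qed (use that positive in auto)
    then show ?thesis
      using integral_pos[OF cont] by force
  next
    case 2
    have "0 < - (y / (m * y - c))" if "y \<in> X" for y
    proof -
      have "m * y - c < 0"
        using mult_left_mono[of y b m] that 2 m_pos unfolding assms(1) atLeastAtMost_iff by linarith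
      then show ?thesis
        using that positive by (auto intro: divide_pos_neg)
    qed
    then have "0 < (\<integral>y. - (y / (m * y - c)) \<partial>P)"
      by (intro integral_pos continuous_on_minus cont)
    then show ?thesis
      by simp
  qed
qed

text \<open>Real \<open>c\<close> reduces to the real integral. Otherwise the imaginary part of the
  integral is \<open>Im c\<close> times the integral of a positive function.\<close>

lemma complex_resolvent_integral_nonzero:
  assumes "X = {a..b}" and c: "c \<notin> complex_of_real ` degree_fun P k ` X"
  shows "(\<integral>y. of_real y / (of_real (m * y) - c) \<partial>P) \<noteq> 0"
proof (cases "Im c = 0")
  case True
  then have c_real: "c = of_real (Re c)"
    by (simp add: complex_eq_iff)
  then have "(\<integral>y. of_real y / (of_real (m * y) - c) \<partial>P)
      = (\<integral>y. complex_of_real (y / (m * y - Re c)) \<partial>P)"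
    by (metis of_real_diff of_real_divide)
  moreover have "Re c \<notin> degree_fun P k ` X"
    using c c_real by (metis imageI)
  ultimately show ?thesis
    using real_resolvent_integral_nonzero[OF assms(1)] by (simp del: of_real_divide of_real_diff)
next
  case False
  have nz: "of_real (m * x) - c \<noteq> 0" for x
    using False by (auto simp: complex_eq_iff)
  have cont: "continuous_on X (\<lambda>y. of_real y / (of_real (m * y) - c))"
    using nz by (intro continuous_intros) auto
  \<comment> \<open>Im (1 / z) = - Im z / |z|^2, and z = m y - c has imaginary part
    \<open>- Im c\<close>.\<close>
  have Im_eq: "Im (of_real y / (of_real (m * y) - c)) = Im c * (y / (cmod (of_real (m * y) - c))\<^sup>2)" for y
    by (simp add: Im_divide cmod_power2)
  have "Im (\<integral>y. of_real y / (of_real (m * y) - c) \<partial>P)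
      = (\<integral>y. Im (of_real y / (of_real (m * y) - c)) \<partial>P)"
    using integral_Im[OF integrable_continuous[OF cont]] by simp
  also have "\<dots> = Im c * (\<integral>y. y / (cmod (of_real (m * y) - c))\<^sup>2 \<partial>P)"
    unfolding Im_eq by (rule integral_mult_right_zero)
  also have "0 < (\<integral>y. y / (cmod (of_real (m * y) - c))\<^sup>2 \<partial>P)"
    using positive nz by (intro integral_pos continuous_intros) auto
  then have "Im c * (\<integral>y. y / (cmod (of_real (m * y) - c))\<^sup>2 \<partial>P) \<noteq> 0"
    using False by simp
  finally show ?thesis
    by auto
qed

section \<open>The eigenvalue 0: kernel and generalized eigenspace\<close>

lemma zero_not_in_degree_range:
  "(0::'k::real_normed_field) \<notin> of_real ` degree_fun P k ` X"
  using positive m_pos by (auto simp: degree)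

text \<open>With \<open>B\<close> the integral of y f y, cancelling \<open>x \<noteq> 0\<close> in m
  x f x = x B gives the constant B / m; conversely a constant \<open>b\<close> has B = m b.\<close>

lemma eigenspace_0:
  "eigenspace (cont_space X) (U_op X P k) (0::'k::{real_normed_field, banach, second_countable_topology})
     = range (\<lambda>b x. if x \<in> X then b else 0)" (is "?E = _")
proof (intro equalityI subsetI)
  fix f :: "real \<Rightarrow> 'k" assume f: "f \<in> ?E"
  have "f x = (if x \<in> X then (\<integral>y. of_real y * f y \<partial>P) / of_real m else 0)" for x
  proof (cases "x \<in> X")
    case True
    have "U_op X P k f x = 0"
      using f by (simp add: eigenspace_def scale_fun_def)
    moreover have "x \<noteq> 0"
      using True positive by auto
    ultimately show ?thesis
      using True m_pos by (simp add: U_op_apply field_simps)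
  qed (use f in \<open>auto simp: eigenspace_def cont_space_def\<close>)
  then show "f \<in> range (\<lambda>b x. if x \<in> X then b else 0)"
    by blast
next
  fix f :: "real \<Rightarrow> 'k" assume "f \<in> range (\<lambda>b x. if x \<in> X then b else 0)"
  then obtain b where b: "f = (\<lambda>x. if x \<in> X then b else 0)"
    by blast
  have "continuous_on X f"
    unfolding b by (rule continuous_on_eq[of _ "\<lambda>_. b"]) auto
  moreover have "(\<integral>y. of_real y * f y \<partial>P) = (\<integral>y. of_real y * b \<partial>P)"
    by (intro Bochner_Integration.integral_cong) (auto simp: space_P b)
  then have "(\<integral>y. of_real y * f y \<partial>P) = of_real m * b"
    by (simp add: integral_of_real_id)
  then have "U_op X P k f x = 0" for x
    by (cases "x \<in> X") (simp_all add: U_op_apply, simp_all add: b U_op_def)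
  ultimately show "f \<in> ?E"
    by (auto simp: eigenspace_def cont_space_def scale_fun_def b)
qed

text \<open>This excludes Jordan chains of length two at 0: the kernel consists of constants, and no
  nonzero constant is a value of \<open>U\<close>.\<close>

lemma U_op_const_imp_zero:
  fixes f :: "real \<Rightarrow> 'k::{real_normed_field, banach, second_countable_topology}"
  assumes "\<And>x. x \<in> X \<Longrightarrow> U_op X P k f x = b"
  shows "b = 0"
proof -
  define B where "B = (\<integral>y. of_real y * f y \<partial>P)"
  have m: "of_real m \<noteq> (0 :: 'k)"
    using m_pos by simp
  \<comment> \<open>Thus y f y is affine in y on \<open>X\<close>, hence integrable. Its integral is
    \<open>B\<close> plus the mass times \<open>b / m\<close>, so the last term vanishes.\<close>
  have eq: "of_real y * f y = B / of_real m * of_real y + b / of_real m" if "y \<in> X" for y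
    using assms[OF that] m by (simp add: U_op_apply[OF that] B_def[symmetric] field_simps)
  have "B = (\<integral>y. B / of_real m * of_real y + b / of_real m \<partial>P)"
    by (subst B_def, intro Bochner_Integration.integral_cong) (auto simp: space_P eq)
  also have "\<dots> = (\<integral>y. B / of_real m * of_real y \<partial>P) + (\<integral>y. b / of_real m \<partial>P)"
    by (intro Bochner_Integration.integral_add integrable_continuous continuous_intros)
  also have "\<dots> = B + measure P X *\<^sub>R (b / of_real m)"
    using m by (simp only: integral_mult_right_zero integral_of_real_id) (simp add: space_P scaleR_conv_of_real)
  finally show ?thesis
    using mass m by (simp add: emeasure_eq_measure)
qed

text \<open>Invariance of C(X), so that an induction over powers of \<open>U\<close> can pass from
  \<open>f\<close> to \<open>U f\<close>.\<close>

lemma U_op_cont_space: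
  fixes f :: "real \<Rightarrow> 'k::{real_normed_field, banach, second_countable_topology}"
  assumes "f \<in> cont_space X"
  shows "U_op X P k f \<in> cont_space X"
proof -
  have "continuous_on X (\<lambda>x. of_real (m * x) * f x - of_real x * (\<integral>y. of_real y * f y \<partial>P))"
    using assms by (auto simp: cont_space_def intro!: continuous_intros)
  then have "continuous_on X (U_op X P k f)"
    by (rule continuous_on_eq) (simp add: U_op_apply)
  then show ?thesis
    by (simp add: cont_space_def U_op_def)
qed

lemma generalized_eigenspace_0:
  "generalized_eigenspace (cont_space X) (U_op X P k) 0
     = eigenspace (cont_space X) (U_op X P k) (0::'k::{real_normed_field, banach, second_countable_topology})"
  (is "?G = ?E")
proof (intro equalityI subsetI)
  \<comment> \<open>At the eigenvalue 0 the iterated operator is \<open>U\<close> itself.\<close>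
  have zero: "(\<lambda>g. U_op X P k g - scale_fun 0 g) = (U_op X P k :: (real \<Rightarrow> 'k) \<Rightarrow> _)"
    by (simp add: fun_eq_iff scale_fun_def)
  fix f :: "real \<Rightarrow> 'k"
  {
    assume "f \<in> ?G"
    then obtain n where f: "f \<in> cont_space X" and n: "(U_op X P k ^^ n) f = 0"
      unfolding generalized_eigenspace_def zero by blast
    from f n show "f \<in> ?E"
    proof (induction n arbitrary: f)
      case 0
      then show ?case
        unfolding eigenspace_0 by (auto simp: zero_fun_def intro!: image_eqI[of _ _ 0])
    next
      case (Suc n)
      \<comment> \<open>The induction hypothesis, applied to \<open>U f\<close>, puts
        \<open>U f\<close> in the kernel; it is therefore a constant, which must be 0.\<close>
      have "U_op X P k f \<in> ?E"
        using Suc.prems U_op_cont_space by (intro Suc.IH) (simp_all add: funpow_swap1)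
      then obtain b where b: "U_op X P k f = (\<lambda>x. if x \<in> X then b else 0)"
        unfolding eigenspace_0 by blast
      then have "b = 0"
        by (intro U_op_const_imp_zero[of f]) simp
      then show ?case
        using b Suc.prems(1) by (auto simp: eigenspace_def scale_fun_def)
    qed
  next
    assume "f \<in> ?E"
    then have "f \<in> cont_space X" "(U_op X P k ^^ 1) f = 0"
      by (auto simp: eigenspace_def scale_fun_def zero_fun_def)
    then show "f \<in> ?G"
      unfolding generalized_eigenspace_def zero by blast
  }
qed

section \<open>Multiplicities and the eigenvalues outside the range\<close>

lemma dim_eigenspace_0:
  "function_space.dim (eigenspace (cont_space X) (U_op X P k)
     (0::'k::{real_normed_field, banach, second_countable_topology})) = 1"
proof -
  define e :: "real \<Rightarrow> 'k" where "e = (\<lambda>x. if x \<in> X then 1 else 0)"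
  have "e \<noteq> 0"
    using X_nonempty by (auto simp: e_def fun_eq_iff)
  then have indep: "function_space.independent {e}"
    by simp
  \<comment> \<open>The indicator \<open>e\<close> of \<open>X\<close> is a basis of the constants
    on \<open>X\<close>.\<close>
  have "eigenspace (cont_space X) (U_op X P k) (0::'k) = function_space.span {e}"
    unfolding eigenspace_0 function_space.span_singleton
    by (intro arg_cong[of _ _ range]) (auto simp: fun_eq_iff e_def scale_fun_def)
  then show ?thesis
    using function_space.dim_span_eq_card_independent[OF indep] by simp
qed

text \<open>Taking the nonvanishing of the integral as a premise lets one argument serve both real
  and complex scalars.\<close>

lemma eigenvalues_outside_degree_range:
  assumes nonzero: "\<And>c::'k::{real_normed_field, banach, second_countable_topology}. c \<notin> of_real ` degree_fun P k ` X
      \<Longrightarrow> (\<integral>y. of_real y / (of_real (m * y) - c) \<partial>P) \<noteq> 0"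
  shows "{c::'k. eigenvalue (cont_space X) (U_op X P k) c \<and> c \<notin> of_real ` degree_fun P k ` X} = {0}"
proof -
  have "eigenvalue (cont_space X) (U_op X P k) (0::'k)"
  proof -
    have "(\<lambda>x. if x \<in> X then 1 else 0) \<noteq> (0 :: real \<Rightarrow> 'k)"
      using X_nonempty by (auto simp: fun_eq_iff)
    then show ?thesis
      unfolding eigenvalue_def eigenspace_0 by blast
  qed
  moreover have "c = 0"
    if "eigenvalue (cont_space X) (U_op X P k) c" "c \<notin> of_real ` degree_fun P k ` X" for c :: 'k
    using that nonzero[OF that(2)] resolvent_integral_zero[of _ c] unfolding eigenvalue_def by blast
  ultimately show ?thesis
    using zero_not_in_degree_range[where 'k='k] by auto
qed

text \<open>Both multiplicities are the dimension of the same space.\<close>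

lemmas multiplicities = dim_eigenspace_0[folded geometric_multiplicity_def]
  dim_eigenspace_0[folded generalized_eigenspace_0, folded algebraic_multiplicity_def]

end

section \<open>The piecewise constant density and the conclusion\<close>

lemma emeasure_piecewise_density:
  fixes s :: real
  assumes "0 \<le> s" "s \<le> 3"
  shows "emeasure (density (restrict_space lborel {1..2::real})
    (\<lambda>x. ennreal (if 4/3 \<le> x \<and> x < 5/3 then s else (3 - s) / 2))) {1..2} = 1"
proof -
  let ?p = "\<lambda>x::real. if 4/3 \<le> x \<and> x < 5/3 then s else (3 - s) / 2"
  have "emeasure (density (restrict_space lborel {1..2}) (\<lambda>x. ennreal (?p x))) {1..2}
      = (\<integral>\<^sup>+x. ennreal (?p x) * indicator {1..2} x \<partial>restrict_space lborel {1..2})"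
    by (rule emeasure_density) (auto simp: sets_restrict_space intro!: measurable_restrict_space1)
  also have "\<dots> = (\<integral>\<^sup>+x. ennreal (?p x) * indicator {1..2} x * indicator {1..2} x \<partial>lborel)"
    by (rule nn_integral_restrict_space) simp
  \<comment> \<open>These three intervals partition [1,2] exactly as the density does, endpoints
    included; each has length 1/3.\<close>
  also have "\<dots> = (\<integral>\<^sup>+x. (ennreal s * indicator {4/3..<5/3::real} x
      + ennreal ((3 - s) / 2) * indicator {1..<4/3::real} x)
      + ennreal ((3 - s) / 2) * indicator {5/3..2::real} x \<partial>lborel)"
    by (intro nn_integral_cong) (auto simp: indicator_def)
  also have "\<dots> = ennreal s * ennreal (1/3) + ennreal ((3 - s) / 2) * ennreal (1/3)
      + ennreal ((3 - s) / 2) * ennreal (1/3)"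
    by (simp add: nn_integral_add nn_integral_cmult)
  \<comment> \<open>The bounds on \<open>s\<close> make both heights nonnegative, so
    \<open>ennreal\<close> truncates nothing; the heights add up to s + (3 - s) = 3.\<close>
  also have "\<dots> = 1"
    using assms by (simp add: ennreal_mult[symmetric] ennreal_plus[symmetric] field_simps del: ennreal_plus)
  finally show ?thesis .
qed

theorem mainTheorem5:
  fixes s :: real and X :: "real set" and p :: "real \<Rightarrow> real"
    and P :: "real measure" and k :: "real \<Rightarrow> real \<Rightarrow> real"
    and U\<^sub>R :: "(real \<Rightarrow> real) \<Rightarrow> real \<Rightarrow> real"
    and U\<^sub>C :: "(real \<Rightarrow> complex) \<Rightarrow> real \<Rightarrow> complex"
  assumes "0 \<le> s" and "s \<le> 3"
    and "X = {1..2}"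
    and "p = (\<lambda>x. if 4/3 \<le> x \<and> x < 5/3 then s else (3 - s) / 2)"
    and "P = density (restrict_space lborel X) (\<lambda>x. ennreal (p x))"
    and "k = (\<lambda>x y. x * y)"
    and "U\<^sub>R = U_op X P k"
    and "U\<^sub>C = U_op X P k"
  shows "{c. eigenvalue (cont_space X) U\<^sub>R c \<and> c \<notin> degree_fun P k ` X} = {0}
       \<and> geometric_multiplicity (cont_space X) U\<^sub>R 0 = 1
       \<and> algebraic_multiplicity (cont_space X) U\<^sub>R 0 = 1
       \<and> {c. eigenvalue (cont_space X) U\<^sub>C c \<and> c \<notin> complex_of_real ` degree_fun P k ` X} = {0}
       \<and> geometric_multiplicity (cont_space X) U\<^sub>C 0 = 1
       \<and> algebraic_multiplicity (cont_space X) U\<^sub>C 0 = 1"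
proof -
  have mass: "emeasure P X = 1"
    using emeasure_piecewise_density[OF assms(1,2)] unfolding assms(3-5) .
  have sets_P: "sets P = sets (restrict_space borel X)"
    by (simp add: assms(5) sets_restrict_space)
  have space_P: "space P = X"
    using sets_eq_imp_space_eq[OF sets_P] by (simp add: space_restrict_space)
  \<comment> \<open>Mass 1 serves twice: it is finite here and nonzero for
    \<open>product_kernel\<close>.\<close>
  interpret finite_measure P
    by (rule finite_measureI) (simp add: space_P mass)
  interpret product_kernel P X
    by standard (simp_all add: mass sets_P space_P, simp_all add: assms(3) subset_iff)
  \<comment> \<open>For real scalars \<open>of_real\<close> is the identity, so the general range
    becomes \<open>degree_fun P k\<close> on \<open>X\<close>.\<close>
  show ?thesis
    unfolding \<open>U\<^sub>R = _\<close> \<open>U\<^sub>C = _\<close> \<open>k = _\<close>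
    using multiplicities[where 'k=real] multiplicities[where 'k=complex]
      eigenvalues_outside_degree_range[where 'k=real]
      eigenvalues_outside_degree_range[where 'k=complex]
      real_resolvent_integral_nonzero[OF assms(3)] complex_resolvent_integral_nonzero[OF assms(3)]
    by simp
qed

end
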